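(* Let $m\ge0$ be a fixed integer and $\alpha\in\mathbb{R}$. Then $$\begin{aligned} L^{I,\alpha}_{m,n}&=-L^{(\alpha-1)}_{\emptyset,(m),n}, && n\ge m,\\ L^{II,\alpha}_{m,n}&=(-1)^{\frac{m(m+3)}{2}}(2m-n-\alpha-1)\cdot L^{(\alpha-m)}_{\emptyset,(1,\dots,1),n}, && n\ge m,\\ L^{III,\alpha}_{m,n}&=-n\cdot L^{(\alpha-m)}_{(1,\dots,1),\emptyset,n}, && n>m, \end{aligned}$$ where $(1,\dots,1)$ is the partition consisting of $m$ entries equal to $1$.
   Context: For $\alpha\in\mathbb{R}$ and an integer $n\ge 0$, $L^{(\alpha)}_n(x)=\frac{e^x x^{-\alpha}}{n!}\frac{d^n}{dx^n}\left(e^{-x}x^{n+\alpha}\right)$ is the Laguerre polynomial of degree $n$ (so $L_n^{(\alpha)}(x)=\sum_{k=0}^n\binom{n+\alpha}{n-k}\frac{(-x)^k}{k!}$), and $L^{(\alpha)}_n\equiv0$ for $n\le-1$. The type I, II, III $X_m$-Laguerre polynomials are $$L^{I,\alpha}_{m,n}(x)=\begin{vmatrix}L_m^{(\alpha)}(-x)&-L^{(\alpha)}_{n-m-1}(x)\\ L_m^{(\alpha-1)}(-x)&L^{(\alpha-1)}_{n-m}(x)\end{vmatrix}\quad(n\ge m),$$ $$L^{II,\alpha}_{m,n}(x)=\begin{vmatrix}xL_m^{(-\alpha-1)}(x)&-L^{(\alpha+1)}_{n-m}(x)\\(m-\alpha-1)L_m^{(-\alpha-2)}(x)&L^{(\alpha+2)}_{n-m-1}(x)\end{vmatrix}\quad(n\ge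 m),$$ $$L^{III,\alpha}_{m,n}(x)=\begin{vmatrix}xL_m^{(-\alpha-1)}(-x)&-L^{(\alpha+1)}_{n-m-1}(x)\\(m+1)L_{m+1}^{(-\alpha-2)}(-x)&L^{(\alpha+2)}_{n-m-2}(x)\end{vmatrix}\quad(n>m).$$ $\mathrm{Wr}[f_1,\dots,f_r]=\det\left(\frac{d^{j-1}}{dx^{j-1}}f_i\right)_{1\le i,j\le r}$ is the Wronskian. A partition $\lambda=(\lambda_1,\dots,\lambda_{p})$ is a weakly decreasing (possibly empty) finite sequence of positive integers; $p$ is its length and $|\lambda|=\sum_j\lambda_j$. For partitions $\lambda$ of length $p$, $\mu$ of length $q$, $\beta\in\mathbb{R}$, and an integer $n$ such that $\sigma:=n-|\lambda|-|\mu|+p\ge0$ and $\sigma\ne\lambda_j+p-j$ for all $j$, the exceptional Laguerre polynomial is $$L^{(\beta)}_{\lambda,\mu,n}(x)=e^{-qx}\,\mathrm{Wr}\left[g_1,\dots,g_{p+q},L^{(\beta)}_{\sigma}\right](x),$$ where $g_j(x)=L^{(\beta)}_{\lambda_j+p-j}(x)$ for $1\le j\le p$ and $g_{p+j}(x)=e^xL^{(\beta)}_{\mu_j+q-j}(-x)$ for $1\le j\le q$. In the first identity $(m)$ is the sequence of length $q=1$ with single entry $m$ (also when $m=0$, where the same formula with $q=1$, $\mu_1=0$ is used). *)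

theory Defs
  imports "HOL-Analysis.Analysis" "Jordan_Normal_Form.Determinant"
begin

text \<open>The polynomials are rendered as functions on the reals: an identity of real polynomials is
  the same as their pointwise equality. \<open>Determinant.det\<close> is the determinant of a matrix with
  carrier (not the type-indexed \<open>Determinants.det\<close>).\<close>

text \<open>The degree is an \<open>int\<close> because negative degrees, for which the polynomial vanishes, occur.
  The sum is the expansion of Rodrigues' formula, which is lemma
  \<open>laguerre_rodrigues\<close>; unlike that formula it makes sense for all real \<open>x\<close>.\<close>

definition laguerre :: "real \<Rightarrow> int \<Rightarrow> real \<Rightarrow> real" where
  "laguerre \<alpha> n x =
     (if n < 0 then 0
      else \<Sum>k\<le>nat n. ((of_int n + \<alpha>) gchoose (nat n - k)) * (- x) ^ k / fact k)"

definition det2 :: "real \<Rightarrow> real \<Rightarrow> real \<Rightarrow> real \<Rightarrow> real" where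
  "det2 a b c d = Determinant.det (mat_of_rows_list 2 [[a, b], [c, d]])"

definition XI_laguerre :: "real \<Rightarrow> nat \<Rightarrow> int \<Rightarrow> real \<Rightarrow> real" where
  "XI_laguerre \<alpha> m n x =
     det2 (laguerre \<alpha> m (- x))       (- laguerre \<alpha> (n - m - 1) x)
          (laguerre (\<alpha> - 1) m (- x)) (laguerre (\<alpha> - 1) (n - m) x)"

definition XII_laguerre :: "real \<Rightarrow> nat \<Rightarrow> int \<Rightarrow> real \<Rightarrow> real" where
  "XII_laguerre \<alpha> m n x =
     det2 (x * laguerre (- \<alpha> - 1) m x)                (- laguerre (\<alpha> + 1) (n - m) x)
          ((real m - \<alpha> - 1) * laguerre (- \<alpha> - 2) m x) (laguerre (\<alpha> + 2) (n - m - 1) x)"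

definition XIII_laguerre :: "real \<Rightarrow> nat \<Rightarrow> int \<Rightarrow> real \<Rightarrow> real" where
  "XIII_laguerre \<alpha> m n x =
     det2 (x * laguerre (- \<alpha> - 1) m (- x))
            (- laguerre (\<alpha> + 1) (n - m - 1) x)
          ((real m + 1) * laguerre (- \<alpha> - 2) (int m + 1) (- x))
            (laguerre (\<alpha> + 2) (n - m - 2) x)"

definition wronskian :: "(real \<Rightarrow> real) list \<Rightarrow> real \<Rightarrow> real" where
  "wronskian fs x =
     Determinant.det
       (mat (length fs) (length fs) (\<lambda>(i, j). (deriv ^^ j) (fs ! i) x))"

text \<open>The sequences \<open>\<lambda>\<close> and \<open>\<mu>\<close> are lists \<open>ls\<close> and \<open>ms\<close>, indexed from 0, so the degree belonging to the mathematical
  \<open>\<lambda>\<^sub>j + p - j\<close> with \<open>j = i + 1\<close> is \<open>ls ! i + p - (i + 1)\<close>; as \<open>i < p\<close>, the subtraction on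
  \<open>nat\<close> does not truncate.\<close>

definition degree_seq :: "nat list \<Rightarrow> nat list" where
  "degree_seq ls = map (\<lambda>i. ls ! i + length ls - Suc i) [0..<length ls]"

definition exc_degree :: "nat list \<Rightarrow> nat list \<Rightarrow> int \<Rightarrow> int" where
  "exc_degree ls ms n = n - int (sum_list ls) - int (sum_list ms) + int (length ls)"

text \<open>The condition under which the exceptional Laguerre polynomial is defined.
  The function \<open>exc_laguerre\<close> below is total; it is only meaningful
  when this condition holds.\<close>

definition exc_admissible :: "nat list \<Rightarrow> nat list \<Rightarrow> int \<Rightarrow> bool" where
  "exc_admissible ls ms n \<longleftrightarrow>
     exc_degree ls ms n \<ge> 0 \<and> (\<forall>d\<in>set (degree_seq ls). exc_degree ls ms n \<noteq> int d)"

definition exc_laguerre :: "real \<Rightarrow> nat list \<Rightarrow> nat list \<Rightarrow> int \<Rightarrow> real \<Rightarrow> real" where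
  "exc_laguerre \<beta> ls ms n x =
     exp (- real (length ms) * x) *
     wronskian
       (map (\<lambda>d. laguerre \<beta> (int d)) (degree_seq ls) @
        map (\<lambda>d. \<lambda>y. exp y * laguerre \<beta> (int d) (- y)) (degree_seq ms) @
        [laguerre \<beta> (exc_degree ls ms n)]) x"

text \<open>The three families of indices for which exceptional Laguerre polynomials are compared with
  \<open>X\<^sub>m\<close>-Laguerre polynomials are admissible.\<close>

lemma exc_admissible_I: "n \<ge> int m \<Longrightarrow> exc_admissible [] [m] n"
  by (simp add: exc_admissible_def exc_degree_def degree_seq_def)

lemma exc_admissible_II: "n \<ge> int m \<Longrightarrow> exc_admissible [] (replicate m 1) n"
  by (simp add: exc_admissible_def exc_degree_def degree_seq_def sum_list_replicate)

lemma exc_admissible_III: "n > int m \<Longrightarrow> exc_admissible (replicate m 1) [] n"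
  by (auto simp: exc_admissible_def exc_degree_def degree_seq_def sum_list_replicate)

lemma higher_deriv_exp_powr:
  fixes \<beta> x :: real
  assumes "x > 0"
  shows "(deriv ^^ k) (\<lambda>t. exp (- t) * t powr \<beta>) x =
    (\<Sum>i\<le>k. fact k * (\<beta> gchoose (k - i)) * (- 1) ^ i / fact i *
            (exp (- x) * x powr (\<beta> - real k + real i)))"
  using assms
proof (induction k arbitrary: x)
  case 0
  then show ?case by simp
next
  case (Suc k)
  define a where "a k i = fact k * (\<beta> gchoose (k - i)) * (- 1) ^ i / fact i" for k i :: nat
  define e where "e i t = exp (- t) * t powr (\<beta> - real k + real i)" for i :: nat and t :: real
  define e' where "e' i = exp (- x) * x powr (\<beta> - real (Suc k) + real i)" for i :: nat
  have e_e': "e i x = e' (Suc i)" for i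
    by (simp add: e_def e'_def algebra_simps)
  have ev: "eventually (\<lambda>t. (deriv ^^ k) (\<lambda>t. exp (- t) * t powr \<beta>) t = (\<Sum>i\<le>k. a k i * e i t))
              (nhds x)"
    using eventually_nhds_in_open[of "{0<..}" x] Suc.prems
    by (auto elim!: eventually_mono simp: Suc.IH a_def e_def)
  have deriv_exp_powr: "((\<lambda>t. exp (- t) * t powr c) has_real_derivative
      - (exp (- x) * x powr c) + c * (exp (- x) * x powr (c - 1))) (at x)" for c
    using Suc.prems
    by (auto intro!: derivative_eq_intros simp: powr_diff)
  have "(e i has_real_derivative - e' (Suc i) + (\<beta> - real k + real i) * e' i) (at x)" for i
    using deriv_exp_powr[of "\<beta> - real k + real i"]
    by (simp add: e_def[abs_def] e'_def algebra_simps)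
  then have "((\<lambda>t. \<Sum>i\<le>k. a k i * e i t) has_real_derivative
      (\<Sum>i\<le>k. a k i * (- e' (Suc i) + (\<beta> - real k + real i) * e' i))) (at x)"
    by (intro DERIV_sum DERIV_cmult)
  then have "(deriv ^^ Suc k) (\<lambda>t. exp (- t) * t powr \<beta>) x =
      (\<Sum>i\<le>k. a k i * (- e' (Suc i) + (\<beta> - real k + real i) * e' i))"
    using deriv_cong_ev[OF ev refl] by (simp add: DERIV_imp_deriv)
  also have "\<dots> = (\<Sum>i\<le>k. a k i * (\<beta> - real k + real i) * e' i) - (\<Sum>i\<le>k. a k i * e' (Suc i))"
    by (simp add: algebra_simps sum.distrib sum_subtractf)
  also have "(\<Sum>i\<le>k. a k i * (\<beta> - real k + real i) * e' i) =
      (\<Sum>i\<le>k. (real (Suc k) - real i) / real (Suc k) * a (Suc k) i * e' i)"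
  proof (rule sum.cong[OF refl])
    fix i assume "i \<in> {..k}"
    then obtain j where j: "k = i + j" by (auto simp: le_iff_add)
    have "(\<beta> gchoose j) * (\<beta> - real j) = real (Suc j) * (\<beta> gchoose Suc j)"
      by (metis gbinomial_absorb_comp gbinomial_absorption mult.commute)
    then have *: "(\<beta> gchoose j) * (\<beta> - real k + real i) = real (Suc j) * (\<beta> gchoose Suc j)"
      by (simp add: j)
    have "a k i * (\<beta> - real k + real i) =
        ((\<beta> gchoose j) * (\<beta> - real k + real i)) * (fact k * (- 1) ^ i / fact i)"
      by (simp add: a_def j)
    also have "\<dots> = (real (Suc k) - real i) / real (Suc k) * a (Suc k) i"
      unfolding * by (simp add: a_def j Suc_diff_le divide_simps del: of_nat_Suc)
    finally show "a k i * (\<beta> - real k + real i) * e' i =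
        (real (Suc k) - real i) / real (Suc k) * a (Suc k) i * e' i" by simp
  qed
  also have "\<dots> = (\<Sum>i\<le>Suc k. (real (Suc k) - real i) / real (Suc k) * a (Suc k) i * e' i)"
    by simp
  also have "(\<Sum>i\<le>k. a k i * e' (Suc i)) =
      (\<Sum>i\<le>k. - (real (Suc i) / real (Suc k) * a (Suc k) (Suc i) * e' (Suc i)))"
    by (rule sum.cong) (auto simp: a_def divide_simps simp del: of_nat_Suc)
  also have "\<dots> = - (\<Sum>i\<le>Suc k. real i / real (Suc k) * a (Suc k) i * e' i)"
    by (subst sum.atMost_Suc_shift) (simp add: sum_negf)
  also have "(\<Sum>i\<le>Suc k. (real (Suc k) - real i) / real (Suc k) * a (Suc k) i * e' i) -
      - (\<Sum>i\<le>Suc k. real i / real (Suc k) * a (Suc k) i * e' i) =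
      (\<Sum>i\<le>Suc k. a (Suc k) i * e' i)"
    unfolding diff_minus_eq_add sum.distrib[symmetric] distrib_right[symmetric]
      add_divide_distrib[symmetric]
    by (simp del: of_nat_Suc sum.atMost_Suc)
  finally show ?case by (simp only: a_def e'_def)
qed

lemma laguerre_rodrigues:
  fixes \<alpha> x :: real
  assumes "x > 0"
  shows "laguerre \<alpha> (int n) x =
    exp x * x powr (- \<alpha>) / fact n * (deriv ^^ n) (\<lambda>t. exp (- t) * t powr (real n + \<alpha>)) x"
proof -
  have *: "x powr (- \<alpha>) * x powr (\<alpha> + real k) = x ^ k" for k
    using assms by (simp flip: powr_add add: powr_realpow)
  have "laguerre \<alpha> (int n) x =
      (\<Sum>k\<le>n. (real n + \<alpha> gchoose (n - k)) * (- 1) ^ k / fact k *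
              (x powr (- \<alpha>) * x powr (\<alpha> + real k)))"
    unfolding * laguerre_def by (simp add: power_minus[of x] mult.assoc)
  also have "\<dots> = exp x * x powr (- \<alpha>) / fact n *
      (\<Sum>k\<le>n. fact n * (real n + \<alpha> gchoose (n - k)) * (- 1) ^ k / fact k *
              (exp (- x) * x powr (real n + \<alpha> - real n + real k)))"
    unfolding sum_distrib_left by (rule sum.cong) (auto simp: exp_minus field_simps)
  finally show ?thesis
    by (simp only: higher_deriv_exp_powr[OF assms])
qed

end

theory Submission
  imports Defs
begin

text \<open>The first identity is the expansion of a 2 x 2 Wronskian. For the other two put
  \<open>b = \<alpha> - m\<close> and \<open>a = - b - 1\<close>, and let \<open>T f = \<Sum>\<^sub>j\<^sub>\<le>\<^sub>m (- 1)\<^sup>j L\<^sub>j\<^sup>(\<^sup>a\<^sup>-\<^sup>j\<^sup>)(- x) f\<^sup>(\<^sup>j\<^sup>)(x)\<close>.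
  The derivative of \<open>T f\<close> telescopes to a single term; comparing derivatives and the values at 0
  identifies \<open>T\<close> applied to the last entry of the Wronskian, times the scalar factor of the identity,
  with the \<open>X\<^sub>m\<close>-Laguerre polynomial up to sign, and shows that \<open>T\<close> annihilates \<open>L\<^sub>1\<^sup>(\<^sup>b\<^sup>)\<close>, ..., \<open>L\<^sub>m\<^sup>(\<^sup>b\<^sup>)\<close>. Replacing the first column of the Wronskian matrix
  by the combination \<open>T\<close> of its columns therefore leaves one entry in that column, and its minor is
  triangular along the antidiagonal. For the second identity the factors \<open>e\<^sup>x\<close> are first pulled out
  of the Wronskian, which turns its last entry into \<open>e\<^sup>-\<^sup>x L\<^sub>N\<^sup>(\<^sup>b\<^sup>)\<close>, and \<open>T\<close> is replaced by its
  conjugate under \<open>x \<mapsto> - x\<close>.\<close>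

section \<open>Laguerre polynomials: derivative, contiguous relation, differential equation\<close>

lemma laguerre_neg: "n < 0 \<Longrightarrow> laguerre a n x = 0"
  by (simp add: laguerre_def)

lemma laguerre_0: "laguerre a 0 x = 1"
  by (simp add: laguerre_def)

lemma laguerre_at_0: "laguerre a (int n) 0 = (real n + a) gchoose n"
proof -
  have "laguerre a (int n) 0 = (\<Sum>k\<le>n. if k = 0 then (real n + a) gchoose n else 0)"
    unfolding laguerre_def by (auto intro!: sum.cong)
  then show ?thesis by simp
qed

text \<open>The pairs \<open>(a, n)\<close> and \<open>(a + 1, n - 1)\<close> share the upper
  argument \<open>n + a\<close> of the binomial coefficients, so termwise differentiation only
  shifts the index.\<close>

lemma has_real_derivative_laguerre:
  "(laguerre a n has_real_derivative - laguerre (a + 1) (n - 1) x) (at x)"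
proof (cases n "0::int" rule: linorder_cases)
  case less
  then have "laguerre a n = (\<lambda>_. 0)" by (auto simp: laguerre_neg)
  then show ?thesis using less by (simp add: laguerre_neg)
next
  case equal
  then have "laguerre a n = (\<lambda>_. 1)" by (auto simp: laguerre_0)
  then show ?thesis using equal by (simp add: laguerre_neg)
next
  case greater
  define N where "N = nat (n - 1)"
  with greater have n: "n = int (Suc N)" by simp
  define c where "c k = (real (Suc N) + a) gchoose (Suc N - k)" for k
  have L: "laguerre a n = (\<lambda>x. \<Sum>k\<le>Suc N. c k * (- x) ^ k / fact k)"
    unfolding n laguerre_def c_def by (simp del: sum.atMost_Suc of_nat_Suc)
  have "(laguerre a n has_real_derivative
      (\<Sum>k\<le>Suc N. c k * (real k * (- x) ^ (k - 1) * (- 1)) / fact k)) (at x)"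
    unfolding L by (rule DERIV_sum) (auto intro!: derivative_eq_intros)
  also have "(\<Sum>k\<le>Suc N. c k * (real k * (- x) ^ (k - 1) * (- 1)) / fact k) =
      (\<Sum>k\<le>N. - (c (Suc k) * (- x) ^ k / fact k))"
    by (subst sum.atMost_Suc_shift) (auto intro!: sum.cong simp: divide_simps simp del: of_nat_Suc)
  also have "\<dots> = - laguerre (a + 1) (n - 1) x"
    unfolding n laguerre_def c_def by (simp add: sum_negf algebra_simps)
  finally show ?thesis .
qed

lemmas DERIV_laguerre [derivative_intros] =
  has_real_derivative_laguerre[THEN DERIV_chain2]

text \<open>Identities between Laguerre polynomials are reduced by this to identities of derivatives
  and to recurrences between values at 0.\<close>

lemma eq_if_deriv_eq:
  fixes f g :: "real \<Rightarrow> real"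
  assumes "\<And>x. (f has_real_derivative d x) (at x)"
    and "\<And>x. (g has_real_derivative d x) (at x)" and "f 0 = g 0"
  shows "f x = g x"
proof -
  have "((\<lambda>x. f x - g x) has_real_derivative 0) (at x)" for x
    using DERIV_diff[OF assms(1,2)] by simp
  then show ?thesis
    using DERIV_isconst_all[of "\<lambda>x. f x - g x" x 0] assms(3) by simp
qed

text \<open>Differentiation turns the identity into its negative for parameter \<open>a + 1\<close>
  and degree one less; at 0 it is Pascal's rule for \<open>gchoose\<close>.\<close>

lemma laguerre_pascal:
  "laguerre (a + 1) n x = laguerre a n x + laguerre (a + 1) (n - 1) x"
proof -
  have "laguerre (a + 1) (int N) x = laguerre a (int N) x + laguerre (a + 1) (int N - 1) x" for N
  proof (induction N arbitrary: a x)
    case 0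
    show ?case by (simp add: laguerre_0 laguerre_neg)
  next
    case (Suc N)
    show ?case
    proof (rule eq_if_deriv_eq[of _ _
          "\<lambda>x. laguerre a (int (Suc N)) x + laguerre (a + 1) (int (Suc N) - 1) x"])
      show "(laguerre (a + 1) (int (Suc N)) has_real_derivative
          - laguerre (a + 1 + 1) (int N) x) (at x)" for x
        using has_real_derivative_laguerre[of "a + 1" "int (Suc N)" x] by simp
      show "((\<lambda>x. laguerre a (int (Suc N)) x + laguerre (a + 1) (int (Suc N) - 1) x)
          has_real_derivative - laguerre (a + 1 + 1) (int N) x) (at x)" for x
        using Suc.IH[of "a + 1" x] by (auto intro!: derivative_eq_intros simp: algebra_simps)
      show "laguerre (a + 1) (int (Suc N)) 0 =
          laguerre a (int (Suc N)) 0 + laguerre (a + 1) (int (Suc N) - 1) 0"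
        using laguerre_at_0[of "a + 1" "Suc N"] laguerre_at_0[of a "Suc N"]
          laguerre_at_0[of "a + 1" N] gbinomial_Suc_Suc[of "real N + 1 + a" N]
        by (simp add: algebra_simps)
    qed
  qed
  from this[of "nat n"] show ?thesis
    by (cases "n < 0") (auto simp: laguerre_neg)
qed

text \<open>This is x y'' + (a + 1 - x) y' + n y = 0 for y = \<open>laguerre a n\<close>, with the
  derivatives written out. Differentiating the left side gives, up to sign, the left side for
  \<open>a + 1\<close> and \<open>n - 1\<close>.\<close>

lemma laguerre_ode:
  "x * laguerre (a + 2) (n - 2) x - (a + 1 - x) * laguerre (a + 1) (n - 1) x
     + of_int n * laguerre a n x = 0"
proof -
  have "x * laguerre (a + 2) (int N - 2) x - (a + 1 - x) * laguerre (a + 1) (int N - 1) x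
     + real N * laguerre a (int N) x = 0" for N
  proof (induction N arbitrary: a x)
    case 0
    show ?case by (simp add: laguerre_neg)
  next
    case (Suc N)
    have IH: "x * laguerre (a + 3) (int N - 2) x - (a + 2 - x) * laguerre (a + 2) (int N - 1) x
     + real N * laguerre (a + 1) (int N) x = 0" for x
      using Suc.IH[of x "a + 1"] by (simp add: add.assoc)
    show ?case
    proof (rule eq_if_deriv_eq[of "\<lambda>x. x * laguerre (a + 2) (int (Suc N) - 2) x
           - (a + 1 - x) * laguerre (a + 1) (int (Suc N) - 1) x
           + real (Suc N) * laguerre a (int (Suc N)) x" _ "\<lambda>_. 0"])
      show "((\<lambda>x. x * laguerre (a + 2) (int (Suc N) - 2) x
           - (a + 1 - x) * laguerre (a + 1) (int (Suc N) - 1) x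
           + real (Suc N) * laguerre a (int (Suc N)) x) has_real_derivative 0) (at x)" for x
        by (rule derivative_eq_intros refl)+ (use IH[of x] in \<open>simp add: algebra_simps\<close>)
      have "real (Suc N) * ((a + (1 + real N)) gchoose Suc N) = (a + 1) * ((a + (1 + real N)) gchoose N)"
        using gbinomial_absorb_comp[of "a + (1 + real N)" N] gbinomial_absorption[of N "a + (1 + real N)"]
        by (simp add: algebra_simps)
      then show "0 * laguerre (a + 2) (int (Suc N) - 2) 0
           - (a + 1 - 0) * laguerre (a + 1) (int (Suc N) - 1) 0
           + real (Suc N) * laguerre a (int (Suc N)) 0 = 0"
        using laguerre_at_0[of a "Suc N"] laguerre_at_0[of "a + 1" N] by (simp add: algebra_simps)
    qed simp
  qed
  from this[of "nat n"] show ?thesis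
    by (cases "n < 0") (auto simp: laguerre_neg)
qed

section \<open>Antitriangular determinants and replacement of a column\<close>

text \<open>Expansion along the last column leaves only the top entry, and its minor is again
  antitriangular.\<close>

lemma det_antitriangular:
  fixes A :: "'a :: comm_ring_1 mat"
  assumes "A \<in> carrier_mat m m"
    and "\<And>r c. r < m \<Longrightarrow> c < m \<Longrightarrow> m \<le> r + c \<Longrightarrow> A $$ (r, c) = 0"
  shows "Determinant.det A = (\<Prod>r<m. (- 1) ^ r * A $$ (r, m - Suc r))"
  using assms
proof (induction m arbitrary: A)
  case 0
  then show ?case by (simp add: det_dim_zero)
next
  case (Suc m)
  define B where "B = mat_delete A 0 m"
  have B: "B \<in> carrier_mat m m"
    using mat_delete_carrier[OF Suc.prems(1)] by (simp add: B_def)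
  have B_eq: "B $$ (r, c) = A $$ (Suc r, c)" if "r < m" "c < m" for r c
    using that Suc.prems(1) by (auto simp: B_def mat_delete_def)
  have "Determinant.det A = (\<Sum>r<Suc m. A $$ (r, m) * cofactor A r m)"
    by (rule laplace_expansion_column[OF Suc.prems(1)]) simp
  also have "\<dots> = A $$ (0, m) * cofactor A 0 m"
    using Suc.prems(2) by (subst sum.lessThan_Suc_shift) simp
  also have "cofactor A 0 m = (- 1) ^ m * Determinant.det B"
    by (simp add: cofactor_def B_def)
  also have "Determinant.det B = (\<Prod>r<m. (- 1) ^ r * B $$ (r, m - Suc r))"
    by (rule Suc.IH[OF B]) (simp add: B_eq Suc.prems(2))
  also have "\<dots> = (\<Prod>r<m. (- 1) ^ r * A $$ (Suc r, m - Suc r))"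
    by (intro prod.cong) (auto simp: B_eq)
  \<comment> \<open>The cofactor sign gives one factor -1 to each of the \<open>m\<close> remaining
    rows, whose index in \<open>A\<close> is one higher than in \<open>B\<close>.\<close>
  also have "A $$ (0, m) * ((- 1) ^ m * \<dots>) = (\<Prod>r<Suc m. (- 1) ^ r * A $$ (r, Suc m - Suc r))"
  proof -
    have "(\<Prod>r<m. (- 1) * g r) = (- 1) ^ m * (\<Prod>r<m. g r)" for g :: "nat \<Rightarrow> 'a"
      by (simp only: prod.distrib prod_constant card_lessThan)
    from this[of "\<lambda>r. (- 1) ^ r * A $$ (Suc r, m - Suc r)"] show ?thesis
      by (simp add: prod.lessThan_Suc_shift del: prod.lessThan_Suc)
  qed
  finally show ?case .
qed

text \<open>The new column 0 contains the old one \<open>c 0\<close> times, hence the factor on the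
  left, which need not be invertible. Expansion along this column leaves the last row only.\<close>

lemma det_annihilated:
  fixes A :: "'a :: comm_ring_1 mat"
  assumes A: "A \<in> carrier_mat (Suc m) (Suc m)"
    and ann: "\<And>r. r < m \<Longrightarrow> (\<Sum>j\<le>m. A $$ (r, j) * c j) = 0"
    and tri: "\<And>r j. r < m \<Longrightarrow> j \<le> m \<Longrightarrow> m < r + j \<Longrightarrow> A $$ (r, j) = 0"
  shows "Determinant.det A * c 0 =
    (- 1) ^ m * (\<Sum>j\<le>m. A $$ (m, j) * c j) * (\<Prod>r<m. (- 1) ^ r * A $$ (r, m - r))"
proof -
  \<comment> \<open>Multiplication by \<open>C\<close> replaces column 0 of \<open>A\<close> by the annihilating combination of the columns.\<close>
  define C where "C = mat (Suc m) (Suc m) (\<lambda>(i, j). if j = 0 then c i else if i = j then 1 else 0)"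
  have C: "C \<in> carrier_mat (Suc m) (Suc m)" by (simp add: C_def)
  have "Determinant.det C = prod_list (diag_mat C)"
    by (rule det_lower_triangular[OF _ C]) (simp add: C_def)
  also have "\<dots> = c 0"
    by (simp add: prod_list_diag_prod C_def prod.atLeast0_lessThan_Suc_shift del: prod.op_ivl_Suc)
  finally have detC: "Determinant.det C = c 0" .
  have AC: "A * C \<in> carrier_mat (Suc m) (Suc m)" using A C by simp
  have AC_entry: "(A * C) $$ (r, j) = (if j = 0 then \<Sum>i\<le>m. A $$ (r, i) * c i else A $$ (r, j))"
    if "r \<le> m" "j \<le> m" for r j
  proof -
    have "(A * C) $$ (r, j) = (\<Sum>i\<le>m. A $$ (r, i) * C $$ (i, j))"
      using that A C by (simp add: scalar_prod_def atLeast0LessThan lessThan_Suc_atMost)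
    also have "\<dots> = (\<Sum>i\<le>m. if j = 0 then A $$ (r, i) * c i else if i = j then A $$ (r, j) else 0)"
      using that(2) by (intro sum.cong) (auto simp: C_def)
    finally show ?thesis using that(2) by (cases "j = 0") simp_all
  qed
  define B where "B = mat_delete (A * C) m 0"
  have B: "B \<in> carrier_mat m m"
    using mat_delete_carrier[OF AC] by (simp add: B_def)
  have B_eq: "B $$ (r, j) = A $$ (r, Suc j)" if "r < m" "j < m" for r j
    using that AC by (auto simp: B_def mat_delete_def AC_entry simp del: index_mult_mat)
  have "Determinant.det A * c 0 = Determinant.det (A * C)"
    using det_mult[OF A C] detC by simp
  also have "\<dots> = (\<Sum>r<Suc m. (A * C) $$ (r, 0) * cofactor (A * C) r 0)"
    by (rule laplace_expansion_column[OF AC]) simp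
  also have "\<dots> = (\<Sum>j\<le>m. A $$ (m, j) * c j) * cofactor (A * C) m 0"
    using ann by (simp add: AC_entry del: index_mult_mat)
  also have "cofactor (A * C) m 0 = (- 1) ^ m * Determinant.det B"
    by (simp add: cofactor_def B_def)
  \<comment> \<open>Deleting column 0 shifts the column index by one, so
    \<open>m \<le> r + j\<close> in \<open>B\<close> becomes the strict condition of
    \<open>tri\<close> for column \<open>Suc j\<close>.\<close>
  also have "Determinant.det B = (\<Prod>r<m. (- 1) ^ r * B $$ (r, m - Suc r))"
    by (rule det_antitriangular[OF B]) (simp add: B_eq tri)
  also have "\<dots> = (\<Prod>r<m. (- 1) ^ r * A $$ (r, m - r))"
    by (intro prod.cong) (auto simp: B_eq Suc_diff_Suc)
  finally show ?thesis by (simp add: mult_ac)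
qed

section \<open>Wronskians of families with known derivatives\<close>

text \<open>If differentiation raises the index of \<open>F\<close>, then \<open>F\<close> lists all
  iterated derivatives at once. Laguerre polynomials supply such families in closed form.\<close>

lemma higher_deriv_eqI:
  fixes F :: "nat \<Rightarrow> real \<Rightarrow> real"
  assumes "\<And>j x. (F j has_real_derivative F (Suc j) x) (at x)"
  shows "(deriv ^^ j) (F 0) = F j"
  by (induction j) (auto intro!: DERIV_imp_deriv assms)

lemma higher_deriv_exp_mult:
  fixes F :: "nat \<Rightarrow> real \<Rightarrow> real"
  assumes F: "\<And>j x. (F j has_real_derivative F (Suc j) x) (at x)"
  shows "(deriv ^^ j) (\<lambda>x. exp x * F 0 x) = (\<lambda>x. exp x * (\<Sum>k\<le>j. real (j choose k) * F k x))"
proof -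
  define G where "G j x = exp x * (\<Sum>k\<le>j. real (j choose k) * F k x)" for j x
  have "(G j has_real_derivative G (Suc j) x) (at x)" for j x
  proof -
    have "(G j has_real_derivative exp x * (\<Sum>k\<le>j. real (j choose k) * F (Suc k) x)
        + exp x * (\<Sum>k\<le>j. real (j choose k) * F k x)) (at x)"
      unfolding G_def[abs_def]
      by (rule DERIV_cong, rule DERIV_mult[OF DERIV_exp DERIV_sum], rule DERIV_cmult[OF F])
         (simp add: mult.commute)
    moreover have "(\<Sum>k\<le>Suc j. real (Suc j choose k) * F k x) =
        (\<Sum>k\<le>j. real (j choose k) * F (Suc k) x) + (\<Sum>k\<le>j. real (j choose k) * F k x)"
    proof -
      \<comment> \<open>As \<open>j choose Suc j\<close> is 0, the range can be extended by one;
        Pascal's rule then works termwise.\<close>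
      have "(\<Sum>k\<le>j. real (j choose k) * F k x) = (\<Sum>k\<le>Suc j. real (j choose k) * F k x)"
        by simp
      then show ?thesis
        by (simp add: sum.atMost_Suc_shift sum.distrib algebra_simps del: sum.atMost_Suc)
    qed
    ultimately show ?thesis by (simp only: G_def distrib_left)
  qed
  from higher_deriv_eqI[of G, OF this, of j] show ?thesis by (simp add: G_def[abs_def])
qed

lemma wronskian_map_upt:
  assumes "\<And>i j x. i < n \<Longrightarrow> (F i j has_real_derivative F i (Suc j) x) (at x)"
  shows "wronskian (map (\<lambda>i. F i 0) [0..<n]) x = Determinant.det (mat n n (\<lambda>(i, j). F i j x))"
  unfolding wronskian_def
  by (intro arg_cong[where f = Determinant.det] cong_mat)
     (simp_all add: higher_deriv_eqI[where F = "F _", OF assms])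

text \<open>The factor acts on the derivatives through a binomial matrix of determinant 1, so only
  one scalar \<open>exp x\<close> per column survives.\<close>

lemma wronskian_exp_mult:
  assumes F: "\<And>i j x. i < n \<Longrightarrow> (F i j has_real_derivative F i (Suc j) x) (at x)"
  shows "wronskian (map (\<lambda>i y. exp y * F i 0 y) [0..<n]) x =
    exp (real n * x) * wronskian (map (\<lambda>i. F i 0) [0..<n]) x"
proof -
  define A where "A = mat n n (\<lambda>(i, j). F i j x)"
  \<comment> \<open>By the Leibniz rule, column \<open>j\<close> of the new Wronskian matrix is \<open>e\<^sup>x\<close> times column \<open>j\<close> of \<open>A * B\<close>.\<close>
  define B where "B = mat n n (\<lambda>(k, j). real (j choose k))"
  have carrier: "A \<in> carrier_mat n n" "B \<in> carrier_mat n n" "A * B \<in> carrier_mat n n"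
    by (auto simp: A_def B_def intro!: mult_carrier_mat)
  have "wronskian (map (\<lambda>i y. exp y * F i 0 y) [0..<n]) x =
      Determinant.det (exp x \<cdot>\<^sub>m (A * B))"
    unfolding wronskian_def
  proof (intro arg_cong[where f = Determinant.det] eq_matI)
    fix i j assume "i < dim_row (exp x \<cdot>\<^sub>m (A * B))" "j < dim_col (exp x \<cdot>\<^sub>m (A * B))"
    then have ij: "i < n" "j < n" using carrier by auto
    have "(\<Sum>k<n. F i k x * real (j choose k)) = (\<Sum>k\<le>j. F i k x * real (j choose k))"
      by (rule sum.mono_neutral_right) (use ij in auto)
    then show "mat (length (map (\<lambda>i y. exp y * F i 0 y) [0..<n]))
          (length (map (\<lambda>i y. exp y * F i 0 y) [0..<n]))
          (\<lambda>(i, j). (deriv ^^ j) (map (\<lambda>i y. exp y * F i 0 y) [0..<n] ! i) x) $$ (i, j) =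
        (exp x \<cdot>\<^sub>m (A * B)) $$ (i, j)"
      using ij higher_deriv_exp_mult[of "F i" j, OF F[OF ij(1)]]
      by (simp add: A_def B_def scalar_prod_def atLeast0LessThan mult.commute)
  qed (use carrier in auto)
  also have "\<dots> = exp x ^ n * (Determinant.det A * Determinant.det B)"
    using carrier by (simp add: det_smult det_mult)
  also have "Determinant.det B = prod_list (diag_mat B)"
    by (rule det_upper_triangular[OF _ carrier(2)]) (auto simp: B_def)
  also have "\<dots> = 1"
    by (simp add: prod_list_diag_prod B_def)
  also have "Determinant.det A = wronskian (map (\<lambda>i. F i 0) [0..<n]) x"
    unfolding A_def by (rule wronskian_map_upt[where F = F, OF F, symmetric])
  finally show ?thesis by (simp add: exp_of_nat_mult)
qed

lemma det2_eq: "det2 a b c d = a * d - b * c"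
proof -
  have "det2 a b c d = (\<Sum>i<2. mat_of_rows_list 2 [[a, b], [c, d]] $$ (i, 0) *
      cofactor (mat_of_rows_list 2 [[a, b], [c, d]]) i 0)"
    unfolding det2_def by (rule laplace_expansion_column) (auto simp: mat_of_rows_list_def)
  then show ?thesis
    by (simp add: numeral_2_eq_2 cofactor_def mat_delete_def det_single mat_of_rows_list_def)
qed

section \<open>The operator T on Laguerre polynomials\<close>

text \<open>In the product rule the term from \<open>a (Suc j)\<close> cancels the one from
  \<open>f j\<close>, and the derivative of \<open>a 0\<close> vanishes; only the derivative of the
  last \<open>f\<close> is left.\<close>

lemma has_real_derivative_telescoping_sum:
  fixes a f :: "nat \<Rightarrow> real \<Rightarrow> real"
  assumes a0: "(a 0 has_real_derivative 0) (at x)"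
    and a: "\<And>j. (a (Suc j) has_real_derivative a j x) (at x)"
    and f: "\<And>j. (f j has_real_derivative - f (Suc j) x) (at x)"
  shows "((\<lambda>x. \<Sum>j\<le>m. a j x * f j x) has_real_derivative - (a m x * f (Suc m) x)) (at x)"
proof (induction m)
  case 0
  show ?case using DERIV_mult[OF a0 f[of 0]] by (simp add: mult.commute)
next
  case (Suc m)
  show ?case using DERIV_add[OF Suc.IH DERIV_mult[OF a[of m] f[of "Suc m"]]]
    by (simp add: algebra_simps)
qed

text \<open>At 0 the differential equation loses its second-order term. The recurrence is kept free
  of division because its factors may vanish.\<close>

lemma laguerre_ode_at_0: "of_int n * laguerre a n 0 = (a + 1) * laguerre (a + 1) (n - 1) 0"
  using laguerre_ode[of 0 a n] by simp

lemma laguerre_shift_at_0: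
  "(a + 1) * laguerre (a + 1) n 0 = (of_int n + a + 1) * laguerre a n 0"
  using laguerre_ode_at_0[of n a] laguerre_pascal[of a n 0]
  by (simp add: algebra_simps)

text \<open>By \<open>laguerre_at_0\<close> the coefficient with index \<open>j\<close> has the
  value \<open>a gchoose j\<close> at 0, so this is the absorption rule, with \<open>a - j\<close>
  expressed through \<open>b\<close>.\<close>

lemma laguerre_lower_shift_at_0:
  assumes "a + b = - 1"
  shows "(real j + 1) * laguerre (a - real (Suc j)) (int (Suc j)) 0 =
    - (b + real j + 1) * laguerre (a - real j) (int j) 0"
proof -
  have *: "a - real j = - (b + real j + 1)"
    using assms by simp
  have "(real j + 1) * laguerre (a - real (Suc j)) (int (Suc j)) 0 =
      (a - real j) * laguerre (a - real j) (int j) 0"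
    using laguerre_ode_at_0[of "int (Suc j)" "a - real (Suc j)"]
    by (simp add: algebra_simps)
  also have "\<dots> = - (b + real j + 1) * laguerre (a - real j) (int j) 0"
    by (rule arg_cong2[where f = "(*)", OF * refl])
  finally show ?thesis .
qed

text \<open>The sum is T applied to \<open>laguerre b n\<close>, whose j-th derivative carries the
  sign (-1)^j that cancels the one in T. Both sides have derivative \<open>d\<close>, the term left
  by telescoping, and agree at 0.\<close>

lemma sum_laguerre_eq_XIII:
  assumes ab: "a + b = - 1"
  shows "of_int n * (\<Sum>j\<le>m. laguerre (a - real j) (int j) (- x) * laguerre (b + real j) (n - int j) x)
    = - XIII_laguerre (b + real m) m n x"
proof (rule eq_if_deriv_eq[where f = "\<lambda>x. _ * (\<Sum>j\<le>m. _ j x)"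
    and g = "\<lambda>x. - XIII_laguerre _ m n x" and x = x])
  define \<alpha> where "\<alpha> = b + real m"
  have \<alpha>: "- \<alpha> - 1 = a - real m" "- \<alpha> - 2 = a - real (Suc m)"
    using ab by (simp_all add: \<alpha>_def)
  have minus_1: "- 1 - \<alpha> = - \<alpha> - 1" by simp
  define d where "d x = - of_int n * (laguerre (- \<alpha> - 1) (int m) (- x) *
      laguerre (\<alpha> + 1) (n - int m - 1) x)" for x
  show "((\<lambda>x. of_int n * (\<Sum>j\<le>m. laguerre (a - real j) (int j) (- x) *
      laguerre (b + real j) (n - int j) x)) has_real_derivative d x) (at x)" for x
  proof -
    have "((\<lambda>x. \<Sum>j\<le>m. laguerre (a - real j) (int j) (- x) * laguerre (b + real j) (n - int j) x)
        has_real_derivative - (laguerre (a - real m) (int m) (- x) *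
          laguerre (b + real (Suc m)) (n - int (Suc m)) x)) (at x)"
      by (rule has_real_derivative_telescoping_sum)
         (auto intro!: derivative_eq_intros simp: algebra_simps laguerre_neg)
    from DERIV_cmult[OF this, of "of_int n"] show ?thesis
      unfolding d_def \<alpha> by (simp add: \<alpha>_def algebra_simps)
  qed
  show "((\<lambda>x. - XIII_laguerre (b + real m) m n x) has_real_derivative d x) (at x)" for x
  proof -
    define W where "W = laguerre (- \<alpha> - 1) (int m) (- x)"
    define W' where "W' = laguerre (- \<alpha>) (int m - 1) (- x)"
    define P where "P = laguerre (- \<alpha> - 2) (int m + 1) (- x)"
    define u where "u = laguerre (\<alpha> + 1) (n - int m - 1) x"
    define u' where "u' = laguerre (\<alpha> + 2) (n - int m - 2) x"
    define u'' where "u'' = laguerre (\<alpha> + 3) (n - int m - 3) x"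
    \<comment> \<open>The differential equation for \<open>u\<close> removes \<open>u''\<close>, and
      the one for \<open>P\<close>, taken at \<open>- x\<close>, removes \<open>W'\<close>.\<close>
    have u: "x * u'' = (\<alpha> + 2 - x) * u' - (of_int n - real m - 1) * u"
      using laguerre_ode[of x "\<alpha> + 1" "n - int m - 1"]
      by (simp add: u_def u'_def u''_def add.assoc algebra_simps)
    have P: "x * W' = (\<alpha> + 1 - x) * W + (real m + 1) * P"
      using laguerre_ode[of "- x" "- \<alpha> - 2" "int m + 1"]
      by (simp add: W_def W'_def P_def minus_1 algebra_simps)
    have "((\<lambda>x. - XIII_laguerre (b + real m) m n x) has_real_derivative
        - (W * u' + (x * W') * u' - W * (x * u'') + (real m + 1) * (W * u - P * u'))) (at x)"
      unfolding XIII_laguerre_def det2_eq \<alpha>_def[symmetric]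
      by (rule derivative_eq_intros refl)+
         (simp add: W_def W'_def P_def u_def u'_def u''_def minus_1 algebra_simps)
    also have "- (W * u' + (x * W') * u' - W * (x * u'') + (real m + 1) * (W * u - P * u')) = d x"
      unfolding u P d_def W_def[symmetric] u_def[symmetric] by (simp add: algebra_simps)
    finally show ?thesis .
  qed
  \<comment> \<open>The partial sums at 0 have a closed form: the next summand changes its factor
    \<open>- (m + 1)\<close> into \<open>n - m - 1\<close>, and the recurrences for \<open>A\<close>
    and \<open>B\<close> move both indices up.\<close>
  have "of_int n * (\<Sum>j\<le>m. laguerre (a - real j) (int j) 0 * laguerre (b + real j) (n - int j) 0) =
      - (real m + 1) * laguerre (a - real (Suc m)) (int (Suc m)) 0 *
        laguerre (b + real (Suc m)) (n - int (Suc m)) 0"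
  proof (induction m)
    case 0
    have "laguerre (a - 1) 1 0 = - b - 1"
      using laguerre_lower_shift_at_0[OF ab, of 0] by (simp add: laguerre_0)
    then show ?case
      using laguerre_ode_at_0[of n b] by (simp add: laguerre_0)
  next
    case (Suc m)
    define A where "A j = laguerre (a - real j) (int j) 0" for j
    define B where "B j = laguerre (b + real j) (n - int j) 0" for j
    have A: "(real m + 2) * A (Suc (Suc m)) = - (b + real m + 2) * A (Suc m)"
      using laguerre_lower_shift_at_0[OF ab, of "Suc m"] by (simp add: A_def algebra_simps)
    have B: "(of_int n - real m - 1) * B (Suc m) = (b + real m + 2) * B (Suc (Suc m))"
      using laguerre_ode_at_0[of "n - int (Suc m)" "b + real (Suc m)"]
      by (simp add: B_def algebra_simps)
    have "of_int n * (\<Sum>j\<le>m. A j * B j) = - (real m + 1) * A (Suc m) * B (Suc m)"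
      using Suc.IH by (simp add: A_def B_def)
    then have "of_int n * (\<Sum>j\<le>Suc m. A j * B j) =
        A (Suc m) * ((of_int n - real m - 1) * B (Suc m))"
      by (simp add: algebra_simps)
    also have "\<dots> = - ((real m + 2) * A (Suc (Suc m))) * B (Suc (Suc m))"
      unfolding A B by (simp add: algebra_simps)
    finally show ?case by (simp add: A_def B_def algebra_simps)
  qed
  then show "of_int n * (\<Sum>j\<le>m. laguerre (a - real j) (int j) (- 0) *
      laguerre (b + real j) (n - int j) 0) = - XIII_laguerre (b + real m) m n 0"
    unfolding XIII_laguerre_def det2_eq \<alpha>_def[symmetric] \<alpha> by (simp add: \<alpha>_def algebra_simps)
qed

text \<open>For \<open>i \<le> m\<close> the second column of the determinant consists of
  polynomials of negative degree, and \<open>i > 0\<close> allows division by \<open>i\<close>. For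
  \<open>i = 0\<close> the sum would be 1.\<close>

lemma sum_laguerre_eq_0:
  assumes "a + b = - 1" "0 < i" "i \<le> m"
  shows "(\<Sum>j\<le>m. laguerre (a - real j) (int j) (- x) * laguerre (b + real j) (int i - int j) x) = 0"
  using sum_laguerre_eq_XIII[of a b "int i" x m] assms
  by (simp add: XIII_laguerre_def det2_eq laguerre_neg)

text \<open>The same comparison for the conjugate of T applied to
  \<open>exp (- x) * laguerre b N x\<close>, whose derivatives keep the degree \<open>N\<close> and
  raise the parameter.\<close>

lemma sum_laguerre_eq_XII:
  assumes ab: "a + b = - 1"
  shows "(of_int N + b + 1) * (\<Sum>j\<le>m. (- 1) ^ j * laguerre (a - real j) (int j) x *
      (exp (- x) * laguerre (b + real j) N x))
    = (- 1) ^ Suc m * (exp (- x) * XII_laguerre (b + real m) m (N + int m) x)"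
proof (rule eq_if_deriv_eq[where f = "\<lambda>x. _ * (\<Sum>j\<le>m. _ j x)"
    and g = "\<lambda>x. _ * (_ x * XII_laguerre _ m _ x)" and x = x])
  define \<alpha> where "\<alpha> = b + real m"
  have \<alpha>: "- \<alpha> - 1 = a - real m" "- \<alpha> - 2 = a - real (Suc m)"
    using ab by (simp_all add: \<alpha>_def)
  have minus_1: "- 1 - \<alpha> = - \<alpha> - 1" by simp
  define d where "d x = - (of_int N + b + 1) * ((- 1) ^ m * exp (- x) *
      laguerre (- \<alpha> - 1) (int m) x * laguerre (\<alpha> + 1) N x)" for x
  show "((\<lambda>x. (of_int N + b + 1) * (\<Sum>j\<le>m. (- 1) ^ j * laguerre (a - real j) (int j) x *
      (exp (- x) * laguerre (b + real j) N x))) has_real_derivative d x) (at x)" for x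
  proof -
    \<comment> \<open>The contiguous relation merges the two terms of the product rule into
      one.\<close>
    have "((\<lambda>x. exp (- x) * laguerre (b + real j) N x) has_real_derivative
        - (exp (- x) * laguerre (b + real (Suc j)) N x)) (at x)" for j
      using laguerre_pascal[of "b + real j" N x]
      by (auto intro!: derivative_eq_intros simp: algebra_simps)
    then have "((\<lambda>x. \<Sum>j\<le>m. (- 1) ^ j * laguerre (a - real j) (int j) x *
          (exp (- x) * laguerre (b + real j) N x))
        has_real_derivative - ((- 1) ^ m * laguerre (a - real m) (int m) x *
          (exp (- x) * laguerre (b + real (Suc m)) N x))) (at x)"
      by (intro has_real_derivative_telescoping_sum)
         (auto intro!: derivative_eq_intros simp: algebra_simps laguerre_neg)
    from DERIV_cmult[OF this, of "of_int N + b + 1"] show ?thesis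
      unfolding d_def \<alpha> by (simp add: \<alpha>_def algebra_simps)
  qed
  show "((\<lambda>x. (- 1) ^ Suc m * (exp (- x) * XII_laguerre (b + real m) m (N + int m) x))
      has_real_derivative d x) (at x)" for x
  proof -
    define W where "W = laguerre (- \<alpha> - 1) (int m) x"
    define W' where "W' = laguerre (- \<alpha>) (int m - 1) x"
    define Q where "Q = laguerre (- \<alpha> - 2) (int m) x"
    define Q' where "Q' = laguerre (- \<alpha> - 1) (int m - 1) x"
    define u where "u = laguerre (\<alpha> + 1) N x"
    define u' where "u' = laguerre (\<alpha> + 2) (N - 1) x"
    define u'' where "u'' = laguerre (\<alpha> + 3) (N - 2) x"
    have u: "x * u'' = (\<alpha> + 2 - x) * u' - of_int N * u"
      using laguerre_ode[of x "\<alpha> + 1" N]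
      by (simp add: u_def u'_def u''_def add.assoc algebra_simps)
    \<comment> \<open>Up to sign \<open>Q'\<close> is the derivative of \<open>Q\<close>. The
      contiguous relations express \<open>W\<close> and \<open>W'\<close> through \<open>Q\<close>
      and its first two derivatives, and the differential equation for \<open>Q\<close> removes the
      second.\<close>
    have W: "W = Q + Q'"
      using laguerre_pascal[of "- \<alpha> - 2" "int m" x] by (simp add: W_def Q_def Q'_def minus_1)
    have "W' = Q' + laguerre (- \<alpha>) (int m - 2) x"
      using laguerre_pascal[of "- \<alpha> - 1" "int m - 1" x] by (simp add: W'_def Q'_def minus_1)
    then have W': "x * W' = - (\<alpha> + 1) * Q' - real m * Q"
      using laguerre_ode[of x "- \<alpha> - 2" "int m"]
      by (simp add: Q_def Q'_def minus_1 algebra_simps)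
    have "((\<lambda>x. (- 1) ^ Suc m * (exp (- x) * XII_laguerre (b + real m) m (N + int m) x))
      has_real_derivative (- 1) ^ Suc m * (exp (- x) * (- (x * W * u' + (real m - \<alpha> - 1) * Q * u)
        + W * u' - (x * W') * u' - W * (x * u'') - (real m - \<alpha> - 1) * (Q' * u + Q * u')))) (at x)"
      unfolding XII_laguerre_def det2_eq \<alpha>_def[symmetric]
      by (rule derivative_eq_intros refl)+
         (simp add: W_def W'_def Q_def Q'_def u_def u'_def u''_def minus_1 algebra_simps)
    also have "(- 1) ^ Suc m * (exp (- x) * (- (x * W * u' + (real m - \<alpha> - 1) * Q * u)
        + W * u' - (x * W') * u' - W * (x * u'') - (real m - \<alpha> - 1) * (Q' * u + Q * u'))) = d x"
      unfolding u W' d_def W_def[symmetric] u_def[symmetric] W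
      by (simp add: \<alpha>_def algebra_simps)
    finally show ?thesis .
  qed
  have D: "(b + real j + 1) * laguerre (b + real (Suc j)) N 0 =
      (of_int N + b + real j + 1) * laguerre (b + real j) N 0" for j
    using laguerre_shift_at_0[of "b + real j" N] by (simp add: algebra_simps)
  \<comment> \<open>Again a closed form of the partial sums: the next summand changes the factor
    \<open>m + 1\<close> into \<open>N + b + m + 2\<close>, which \<open>D\<close> absorbs while its
    index rises.\<close>
  have "(of_int N + b + 1) * (\<Sum>j\<le>m. (- 1) ^ j * laguerre (a - real j) (int j) 0 *
        laguerre (b + real j) N 0) =
      (- 1) ^ Suc m * ((real m + 1) * laguerre (a - real (Suc m)) (int (Suc m)) 0) *
        laguerre (b + real (Suc m)) N 0" for m
  proof (induction m)
    case 0
    have "laguerre (a - 1) 1 0 = - b - 1"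
      using laguerre_lower_shift_at_0[OF ab, of 0] by (simp add: laguerre_0)
    then show ?case
      using D[of 0] by (simp add: laguerre_0) (simp add: algebra_simps)
  next
    case (Suc m)
    define A where "A j = laguerre (a - real j) (int j) 0" for j
    define D where "D j = laguerre (b + real j) N 0" for j
    have A: "(real m + 2) * A (Suc (Suc m)) = - (b + real m + 2) * A (Suc m)"
      using laguerre_lower_shift_at_0[OF ab, of "Suc m"] by (simp add: A_def algebra_simps)
    have "(of_int N + b + 1) * (\<Sum>j\<le>m. (- 1) ^ j * A j * D j) =
        (- 1) ^ Suc m * ((real m + 1) * A (Suc m)) * D (Suc m)"
      using Suc.IH by (simp add: A_def D_def)
    then have "(of_int N + b + 1) * (\<Sum>j\<le>Suc m. (- 1) ^ j * A j * D j) =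
        (- 1) ^ Suc m * A (Suc m) * ((of_int N + b + real m + 2) * D (Suc m))"
      by (simp add: algebra_simps)
    also have "(of_int N + b + real m + 2) * D (Suc m) = (b + real m + 2) * D (Suc (Suc m))"
      using D[of "Suc m"] by (simp add: D_def algebra_simps)
    also have "(- 1) ^ Suc m * A (Suc m) * ((b + real m + 2) * D (Suc (Suc m))) =
        (- 1) ^ Suc (Suc m) * ((real m + 2) * A (Suc (Suc m))) * D (Suc (Suc m))"
      unfolding A by (simp add: algebra_simps)
    finally show ?case by (simp add: A_def D_def algebra_simps)
  qed
  note at_0 = this[of m]
  show "(of_int N + b + 1) * (\<Sum>j\<le>m. (- 1) ^ j * laguerre (a - real j) (int j) 0 *
      (exp (- 0) * laguerre (b + real j) N 0))
    = (- 1) ^ Suc m * (exp (- 0) * XII_laguerre (b + real m) m (N + int m) 0)"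
  proof -
    have *: "a = real m - \<alpha> - 1"
      using ab by (simp add: \<alpha>_def)
    \<comment> \<open>The partial sums end in degree \<open>m + 1\<close>, the determinant contains
      degree \<open>m\<close>; the two recurrences at 0 connect them.\<close>
    have "(real m + 1) * laguerre (a - real (Suc m)) (int (Suc m)) 0 =
        a * laguerre (a - real (Suc m)) (int m) 0"
      using laguerre_ode_at_0[of "int (Suc m)" "a - real (Suc m)"]
        laguerre_shift_at_0[of "a - real (Suc m)" "int m"]
      by (simp add: algebra_simps)
    also have "\<dots> = (real m - \<alpha> - 1) * laguerre (- \<alpha> - 2) (int m) 0"
      unfolding \<alpha> by (rule arg_cong2[where f = "(*)", OF * refl])
    finally have "XII_laguerre \<alpha> m (N + int m) 0 =
        ((real m + 1) * laguerre (a - real (Suc m)) (int (Suc m)) 0) * laguerre (b + real (Suc m)) N 0"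
      by (simp add: XII_laguerre_def det2_eq) (simp add: \<alpha>_def add_ac)
    then show ?thesis
      using at_0 by (simp add: \<alpha>_def mult_ac)
  qed
qed

section \<open>Evaluation of the Wronskians\<close>

text \<open>Here \<open>c\<close> holds the coefficients of T, or of its conjugate, at the point
  \<open>x\<close>; the leading one is the Laguerre polynomial of degree 0.\<close>

lemma wronskian_annihilated:
  assumes F: "\<And>i j x. i < Suc m \<Longrightarrow> (F i j has_real_derivative F i (Suc j) x) (at x)"
    and c: "c 0 = 1"
    and ann: "\<And>i. i < m \<Longrightarrow> (\<Sum>j\<le>m. F i j x * c j) = 0"
    and tri: "\<And>i j. i < m \<Longrightarrow> j \<le> m \<Longrightarrow> m < i + j \<Longrightarrow> F i j x = 0"
  shows "wronskian (map (\<lambda>i. F i 0) [0..<Suc m]) x =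
    (- 1) ^ m * (\<Sum>j\<le>m. F m j x * c j) * (\<Prod>i<m. (- 1) ^ i * F i (m - i) x)"
proof -
  define A where "A = mat (Suc m) (Suc m) (\<lambda>(i, j). F i j x)"
  have A_eq: "A $$ (i, j) = F i j x" if "i \<le> m" "j \<le> m" for i j
    using that by (simp add: A_def)
  have "wronskian (map (\<lambda>i. F i 0) [0..<Suc m]) x = Determinant.det A * c 0"
    unfolding A_def c by (simp add: wronskian_map_upt[where F = F, OF F] del: upt_Suc)
  also have "\<dots> = (- 1) ^ m * (\<Sum>j\<le>m. A $$ (m, j) * c j) * (\<Prod>i<m. (- 1) ^ i * A $$ (i, m - i))"
    by (rule det_annihilated) (auto simp: A_eq ann tri, simp add: A_def)
  finally show ?thesis by (simp add: A_eq)
qed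

lemma wronskian_pair: "wronskian [f, g] x = f x * deriv g x - deriv f x * g x"
proof -
  define A where "A = mat 2 2 (\<lambda>(i, j). (deriv ^^ j) ([f, g] ! i) x)"
  have "wronskian [f, g] x = Determinant.det A"
    by (simp add: wronskian_def A_def numeral_2_eq_2)
  also have "\<dots> = (\<Sum>i<2. A $$ (i, 0) * cofactor A i 0)"
    by (rule laplace_expansion_column) (simp_all add: A_def)
  finally show ?thesis
    by (simp add: A_def numeral_2_eq_2 cofactor_def mat_delete_def det_single)
qed

text \<open>By the contiguous relation, differentiating
  \<open>exp y * laguerre (\<alpha> - 1) m (- y)\<close> only raises the parameter to
  \<open>\<alpha>\<close>, which produces the first column of the determinant.\<close>

lemma exc_laguerre_single:
  "exc_laguerre (\<alpha> - 1) [] [m] n x = - XI_laguerre \<alpha> m n x"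
proof -
  have "deriv (laguerre (\<alpha> - 1) (n - int m)) x = - laguerre \<alpha> (n - int m - 1) x"
    using has_real_derivative_laguerre[of "\<alpha> - 1"] by (intro DERIV_imp_deriv) simp
  moreover have "deriv (\<lambda>y. exp y * laguerre (\<alpha> - 1) (int m) (- y)) x =
      exp x * laguerre \<alpha> (int m) (- x)"
    using laguerre_pascal[of "\<alpha> - 1" "int m" "- x"]
    by (intro DERIV_imp_deriv) (auto intro!: derivative_eq_intros simp: algebra_simps)
  moreover have "exp (- x) * exp x = 1"
    by (simp flip: exp_add)
  ultimately show ?thesis
    unfolding exc_laguerre_def XI_laguerre_def det2_eq
    by (simp add: degree_seq_def exc_degree_def wronskian_pair algebra_simps)
       (simp add: exp_minus field_simps)
qed

lemma exc_laguerre_ones_left: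
  assumes "a + b = - 1"
  shows "exc_laguerre b (replicate m 1) [] n x =
    (\<Sum>j\<le>m. laguerre (a - real j) (int j) (- x) * laguerre (b + real j) (n - int j) x)"
proof -
  \<comment> \<open>The degrees belonging to \<open>m\<close> ones are \<open>m\<close>, ..., 1, and
    the last entry has degree \<open>n - m + m\<close>.\<close>
  define d where "d i = (if i < m then int (m - i) else n)" for i
  define F where "F i j x = (- 1) ^ j * laguerre (b + real j) (d i - int j) x" for i j x
  define c where "c j = (- 1) ^ j * laguerre (a - real j) (int j) (- x)" for j
  have Fc: "F i j x * c j = laguerre (a - real j) (int j) (- x) * laguerre (b + real j) (d i - int j) x"
    for i j
    by (simp add: F_def c_def power_mult_distrib[symmetric])
  have "exc_laguerre b (replicate m 1) [] n x = wronskian (map (\<lambda>i. F i 0) [0..<Suc m]) x"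
    unfolding exc_laguerre_def
    by (auto simp: degree_seq_def exc_degree_def F_def[abs_def] d_def sum_list_replicate
          intro!: arg_cong[where f = "\<lambda>fs. wronskian fs x"])
  also have "\<dots> = (- 1) ^ m * (\<Sum>j\<le>m. F m j x * c j) * (\<Prod>i<m. (- 1) ^ i * F i (m - i) x)"
  proof (rule wronskian_annihilated)
    show "(F i j has_real_derivative F i (Suc j) x) (at x)" for i j x
      unfolding F_def[abs_def] by (auto intro!: derivative_eq_intros simp: algebra_simps)
    show "(\<Sum>j\<le>m. F i j x * c j) = 0" if "i < m" for i
      using sum_laguerre_eq_0[OF assms, where i = "m - i" and m = m and x = x] that by (simp add: Fc d_def)
  qed (auto simp: c_def F_def d_def laguerre_0 laguerre_neg)
  \<comment> \<open>Antidiagonal entries have degree 0 and equal (-1)^(m-i). The total sign has the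
    even exponent m + m^2.\<close>
  also have "(\<Prod>i<m. (- 1) ^ i * F i (m - i) x) = (\<Prod>i<m. (- 1) ^ m)"
    by (rule prod.cong) (auto simp: F_def d_def laguerre_0 simp flip: power_add)
  also have "(- 1) ^ m * (\<Sum>j\<le>m. F m j x * c j) * (\<Prod>i<m. (- 1) ^ m) = (\<Sum>j\<le>m. F m j x * c j)"
    by (cases "even m") simp_all
  finally show ?thesis by (simp add: Fc d_def)
qed

lemma exc_laguerre_ones_right:
  assumes "a + b = - 1"
  shows "exc_laguerre b [] (replicate m 1) (N + int m) x =
    exp x * (- 1) ^ m * (\<Prod>i<m. (- 1) ^ i) *
    (\<Sum>j\<le>m. (- 1) ^ j * laguerre (a - real j) (int j) x * (exp (- x) * laguerre (b + real j) N x))"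
proof -
  \<comment> \<open>The last entry is written as \<open>exp y\<close> times
    \<open>exp (- y) * laguerre b N y\<close>, so that all \<open>m + 1\<close> entries share the
    factor \<open>exp y\<close>. The prefactor of \<open>exc_laguerre\<close> cancels all but one of
    these.\<close>
  define F where "F i j x = (if i < m then laguerre (b + real j) (int (m - i) - int j) (- x)
    else (- 1) ^ j * (exp (- x) * laguerre (b + real j) N x))" for i j x
  define c where "c j = laguerre (a - real j) (int j) x" for j
  have F: "(F i j has_real_derivative F i (Suc j) x) (at x)" for i j x
    using laguerre_pascal[of "b + real j" N x]
    by (cases "i < m") (auto simp: F_def[abs_def] algebra_simps intro!: derivative_eq_intros)
  have "exc_laguerre b [] (replicate m 1) (N + int m) x =
      exp (- real m * x) * wronskian (map (\<lambda>i y. exp y * F i 0 y) [0..<Suc m]) x"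
    unfolding exc_laguerre_def
    by (auto simp: degree_seq_def exc_degree_def F_def[abs_def] sum_list_replicate mult.assoc[symmetric]
          simp flip: exp_add intro!: arg_cong[where f = "\<lambda>fs. wronskian fs x"])
  also have "\<dots> = exp (- real m * x) * exp (real (Suc m) * x) * wronskian (map (\<lambda>i. F i 0) [0..<Suc m]) x"
    by (simp add: wronskian_exp_mult[where F = F, OF F] del: upt_Suc of_nat_Suc)
  also have "exp (- real m * x) * exp (real (Suc m) * x) = exp x"
    by (simp add: algebra_simps flip: exp_add)
  also have "wronskian (map (\<lambda>i. F i 0) [0..<Suc m]) x =
      (- 1) ^ m * (\<Sum>j\<le>m. F m j x * c j) * (\<Prod>i<m. (- 1) ^ i * F i (m - i) x)"
  proof (rule wronskian_annihilated[where F = F, OF F])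
    show "(\<Sum>j\<le>m. F i j x * c j) = 0" if "i < m" for i
      using sum_laguerre_eq_0[OF assms, where i = "m - i" and m = m and x = "- x"] that
      by (simp add: F_def c_def mult.commute)
  qed (auto simp: c_def F_def laguerre_0 laguerre_neg)
  \<comment> \<open>With the argument \<open>- x\<close>, differentiation brings no sign, so the
    antidiagonal entries are 1 and the row signs remain.\<close>
  also have "(\<Prod>i<m. (- 1) ^ i * F i (m - i) x) = (\<Prod>i<m. (- 1) ^ i)"
    by (rule prod.cong) (auto simp: F_def laguerre_0)
  finally show ?thesis by (simp add: F_def c_def mult_ac)
qed

section \<open>Signs and conclusion\<close>

text \<open>The product is (-1)^(m(m-1)/2), and m(m+3)/2 + m(m-1)/2 = m(m+1) is even.\<close>

lemma sign_mult_prod: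
  "(- 1) ^ (m * (m + 3) div 2) * (\<Prod>i<m. (- 1) ^ i) = (1 :: 'a :: comm_ring_1)"
proof (induction m)
  case (Suc m)
  have "Suc m * (Suc m + 3) = m * (m + 3) + (m + 2) * 2"
    by (simp add: algebra_simps)
  then have "Suc m * (Suc m + 3) div 2 = m * (m + 3) div 2 + (m + 2)"
    by (simp only: div_mult_self1)
  then have "(- 1) ^ (Suc m * (Suc m + 3) div 2) * (\<Prod>i<Suc m. (- 1) ^ i) =
      ((- 1) ^ (m * (m + 3) div 2) * (\<Prod>i<m. (- 1) ^ i)) * ((- 1) ^ (m + 2) * (- 1) ^ m :: 'a)"
    by (simp only: power_add prod.lessThan_Suc mult_ac)
  then show ?case
    unfolding Suc.IH by (simp flip: power_add)
qed simp

theorem proposition5p2: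
  fixes m :: nat and \<alpha> :: real
  shows "(\<forall>n::int. n \<ge> int m \<longrightarrow>
            (\<forall>x::real. XI_laguerre \<alpha> m n x = - exc_laguerre (\<alpha> - 1) [] [m] n x)) \<and>
         (\<forall>n::int. n \<ge> int m \<longrightarrow>
            (\<forall>x::real. XII_laguerre \<alpha> m n x =
               (- 1) ^ (m * (m + 3) div 2) * (2 * real m - real_of_int n - \<alpha> - 1) *
               exc_laguerre (\<alpha> - real m) [] (replicate m 1) n x)) \<and>
         (\<forall>n::int. n > int m \<longrightarrow>
            (\<forall>x::real. XIII_laguerre \<alpha> m n x =
               - real_of_int n * exc_laguerre (\<alpha> - real m) (replicate m 1) [] n x))"
proof (intro conjI allI impI)
  fix n :: int and x :: real
  define b where "b = \<alpha> - real m"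
  define a where "a = - b - 1"
  have ab: "a + b = - 1" by (simp add: a_def)
  show "XI_laguerre \<alpha> m n x = - exc_laguerre (\<alpha> - 1) [] [m] n x"
    by (simp add: exc_laguerre_single)
  show "XIII_laguerre \<alpha> m n x = - real_of_int n * exc_laguerre (\<alpha> - real m) (replicate m 1) [] n x"
    using sum_laguerre_eq_XIII[OF ab, where n = n and m = m and x = x]
    unfolding b_def[symmetric] exc_laguerre_ones_left[OF ab] by (simp add: b_def)
  define N where "N = n - int m"
  define S where "S = (\<Sum>j\<le>m. (- 1) ^ j * laguerre (a - real j) (int j) x *
    (exp (- x) * laguerre (b + real j) N x))"
  have exc: "exc_laguerre (\<alpha> - real m) [] (replicate m 1) n x =
      exp x * (- 1) ^ m * (\<Prod>i<m. (- 1) ^ i) * S"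
    using exc_laguerre_ones_right[OF ab, where m = m and N = N and x = x] by (simp add: N_def S_def b_def)
  have S: "(of_int N + b + 1) * S = (- 1) ^ Suc m * (exp (- x) * XII_laguerre \<alpha> m n x)"
    using sum_laguerre_eq_XII[OF ab, where m = m and N = N and x = x] by (simp add: N_def S_def b_def)
  \<comment> \<open>The scalar is \<open>- (of_int N + b + 1)\<close>; its sign raises the exponent
    \<open>m\<close> to \<open>Suc m\<close>.\<close>
  have "(- 1) ^ (m * (m + 3) div 2) * (2 * real m - real_of_int n - \<alpha> - 1) *
      exc_laguerre (\<alpha> - real m) [] (replicate m 1) n x =
      ((- 1) ^ (m * (m + 3) div 2) * (\<Prod>i<m. (- 1) ^ i)) * (- 1) ^ Suc m * exp x *
        ((of_int N + b + 1) * S)"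
    unfolding exc by (simp add: N_def b_def algebra_simps)
  also have "\<dots> = ((- 1) ^ Suc m * (- 1) ^ Suc m) * (exp x * exp (- x)) * XII_laguerre \<alpha> m n x"
    unfolding sign_mult_prod S by (simp only: mult_1 mult_ac)
  also have "\<dots> = XII_laguerre \<alpha> m n x"
    by (simp flip: exp_add power_add mult_2)
  finally show "XII_laguerre \<alpha> m n x =
      (- 1) ^ (m * (m + 3) div 2) * (2 * real m - real_of_int n - \<alpha> - 1) *
      exc_laguerre (\<alpha> - real m) [] (replicate m 1) n x" by simp
qed

end
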